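(* Let $n\in\mathbb{N}$, $l\in\mathbb{N}_0$, $l<n$ and $r\in\mathbb{N}$. Let $1\le p<\infty$, $s>r-1+\frac{n-l}{p}$ and let $d(x)$ be the distance of $x=(x',x'')\in\mathbb{R}^l\times\mathbb{R}^{n-l}$ from $\mathbb{R}^l$. Then there is a constant $c>0$ such that $$\|d^{-s}(\cdot)f|L_p(\mathbb{R}^n)\|\le c\sum_{\alpha\in\mathbb{N}_l^n,\ |\alpha|=r}\|d^{-s+r}(\cdot)D^\alpha f|L_p(\mathbb{R}^n)\|$$ for all $f\in C^r(\mathbb{R}^n)$ with $(D^\beta f)(x',0)=0$ for all $x'\in\mathbb{R}^l$ and all $\beta\in\mathbb{N}_l^n$ with $|\beta|\le r-1$.
   Context: $\mathbb{N}=\{1,2,\dots\}$, $\mathbb{N}_0=\mathbb{N}\cup\{0\}$. $\mathbb{R}^l$ is identified with the plane $\{(x',x'')\in\mathbb{R}^l\times\mathbb{R}^{n-l}:x''=0\}$ in $\mathbb{R}^n$ (the origin if $l=0$), so $d(x)=|x''|$. $\mathbb{N}_l^n=\{\alpha=(\alpha_1,\dots,\alpha_n)\in\mathbb{N}_0^n:\alpha_1=\dots=\alpha_l=0\}$. $C^r(\mathbb{R}^n)$ is the space of all functions $f:\mathbb{R}^n\to\mathbb{C}$ which are $r$-times continuously differentiable and bounded. The notation $\|g|L_p(\mathbb{R}^n)\|$ means the $L_p(\mathbb{R}^n)$ norm of $g$ with respect to Lebesgue measure, with value $\infty$ allowed. *)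

theory Defs
  imports "HOL-Analysis.Analysis"
begin

text \<open>
  The space \<open>R^n\<close> is the type \<open>real^'n\<close> with \<open>n = CARD('n)\<close>. The index type is
  required to be linearly ordered, so that one can speak of the first \<open>l\<close> coordinates.
\<close>

(* The j in {1, ..., n} such that x $ i is the j-th coordinate of x. *)
definition coord_pos :: "'n::{finite,linorder} \<Rightarrow> nat" where
  "coord_pos i = card {..i}"

definition coord_plane :: "nat \<Rightarrow> (real^'n::{finite,linorder}) set" where
  "coord_plane l = {x. \<forall>i. l < coord_pos i \<longrightarrow> x $ i = 0}"

definition plane_dist :: "nat \<Rightarrow> real^'n::{finite,linorder} \<Rightarrow> real" where
  "plane_dist l x = infdist x (coord_plane l)"

definition multi_indices :: "nat \<Rightarrow> ('n::{finite,linorder} \<Rightarrow> nat) set" where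
  "multi_indices l = {\<alpha>. \<forall>i. coord_pos i \<le> l \<longrightarrow> \<alpha> i = 0}"

definition order_of :: "('n::finite \<Rightarrow> nat) \<Rightarrow> nat" where
  "order_of \<alpha> = (\<Sum>i\<in>UNIV. \<alpha> i)"

definition partial_deriv :: "'n::finite \<Rightarrow> (real^'n \<Rightarrow> complex) \<Rightarrow> real^'n \<Rightarrow> complex" where
  "partial_deriv i f x = vector_derivative (\<lambda>t. f (x + t *\<^sub>R axis i 1)) (at 0)"

(* The differentiations are applied in the order x_n, ..., x_1; for the functions of
   class C^r to which this is applied (with |alpha| <= r) the order is irrelevant. *)
definition multi_deriv ::
    "('n \<Rightarrow> nat) \<Rightarrow> (real^'n::{finite,linorder} \<Rightarrow> complex) \<Rightarrow> real^'n::{finite,linorder} \<Rightarrow> complex" where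
  "multi_deriv \<alpha> f =
     foldr (\<lambda>i g. (partial_deriv i ^^ \<alpha> i) g) (sorted_list_of_set UNIV) f"

fun times_cont_diff :: "nat \<Rightarrow> (real^'n::finite \<Rightarrow> complex) \<Rightarrow> bool" where
  "times_cont_diff 0 f \<longleftrightarrow> continuous_on UNIV f"
| "times_cont_diff (Suc r) f \<longleftrightarrow>
     (\<forall>x. f differentiable (at x)) \<and>
     (\<forall>v. times_cont_diff r (\<lambda>x. frechet_derivative f (at x) v))"

(* Only f itself, not its derivatives, is required to be bounded. *)
definition C_space :: "nat \<Rightarrow> (real^'n::finite \<Rightarrow> complex) set" where
  "C_space r = {f. times_cont_diff r f \<and> bounded (range f)}"

(* The case distinction takes the p-th root of an extended nonnegative real. *)
definition Lp_norm :: "real \<Rightarrow> (real^'n::finite \<Rightarrow> complex) \<Rightarrow> ennreal" where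
  "Lp_norm p g =
     (let I = (\<integral>\<^sup>+ x. ennreal (norm (g x) powr p) \<partial>lborel)
      in if I = \<infinity> then \<infinity> else ennreal (enn2real I powr (1 / p)))"

lemma finite_multi_indices_order:
  "finite {\<alpha> \<in> multi_indices l. order_of (\<alpha> :: 'n::{finite,linorder} \<Rightarrow> nat) = r}"
proof (rule finite_subset)
  show "{\<alpha> \<in> multi_indices l. order_of (\<alpha> :: 'n \<Rightarrow> nat) = r} \<subseteq> (\<Pi>\<^sub>E i\<in>UNIV. {..r})"
    by (auto simp: order_of_def intro: member_le_sum)
  show "finite (\<Pi>\<^sub>E i\<in>(UNIV :: 'n set). {..r})"
    by (intro finite_PiE) auto
qed

end

theory Submission
  imports Defs "HOL-Probability.Probability_Measure"
begin

text \<open>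
  Write \<open>T\<^sub>t (x', x'') = (x', t x'')\<close> and \<open>k = n - l\<close>. For \<open>r = 1\<close> the fundamental theorem of calculus
  gives \<open>d\<^bsup>-s\<^esup> \<bar>f\<bar> \<le> \<integral>\<^bsub>0\<^esub>\<^bsup>1\<^esup> t\<^bsup>s-1\<^esup> \<Sum>\<^sub>i (d\<^bsup>1-s\<^esup> \<bar>\<partial>\<^sub>i f\<bar>) (T\<^sub>t x) dt\<close>, the sum being over the directions normal
  to the plane. Since \<open>T\<^sub>t\<close> changes the \<open>p\<close>-th power of the \<open>L\<^sub>p\<close> norm by \<open>t\<^bsup>-k\<^esup>\<close>, Jensen's inequality for
  a suitable power weight in \<open>t\<close> and Tonelli's theorem yield a Hardy inequality, valid because
  \<open>s > k / p\<close>. Applying it \<open>r\<close> times, each time to the normal derivatives with \<open>s\<close> lowered by \<open>1\<close>,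
  bounds \<open>d\<^bsup>-s\<^esup> f\<close> by iterated partial derivatives, which by the symmetry of second derivatives
  are the \<open>D\<^bsup>\<alpha>\<^esup> f\<close>.
\<close>

subsection \<open>Iterated partial derivatives\<close>

lemma has_vector_derivative_along_line:
  fixes f :: "'a::real_normed_vector \<Rightarrow> 'b::real_normed_vector"
  assumes "f differentiable (at (x + t *\<^sub>R v))"
  shows "((\<lambda>t. f (x + t *\<^sub>R v)) has_vector_derivative
           frechet_derivative f (at (x + t *\<^sub>R v)) v) (at t within S)"
proof -
  have 1: "((\<lambda>t. x + t *\<^sub>R v) has_derivative (\<lambda>h. h *\<^sub>R v)) (at t within S)"
    by (auto intro!: derivative_eq_intros)
  have 2: "(f has_derivative frechet_derivative f (at (x + t *\<^sub>R v))) (at (x + t *\<^sub>R v))"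
    using assms by (simp add: frechet_derivative_works)
  have "((\<lambda>t. f (x + t *\<^sub>R v)) has_derivative
      (\<lambda>h. frechet_derivative f (at (x + t *\<^sub>R v)) (h *\<^sub>R v))) (at t within S)"
    using diff_chain_within[OF 1 has_derivative_at_withinI[OF 2]] by (simp add: o_def)
  then show ?thesis
    using linear_frechet_derivative[OF assms] by (simp add: has_vector_derivative_def linear_scale)
qed

lemma partial_deriv_eq_frechet:
  assumes "f differentiable (at x)"
  shows "partial_deriv i f x = frechet_derivative f (at x) (axis i 1)"
  using has_vector_derivative_along_line[of f x 0 "axis i 1" UNIV] assms
  by (auto simp: partial_deriv_def intro!: vector_derivative_at)

lemma continuous_on_times_cont_diff:
  "times_cont_diff r f \<Longrightarrow> continuous_on UNIV f"
  by (cases r) (auto intro!: differentiable_imp_continuous_on simp: differentiable_on_def)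

lemma times_cont_diff_Suc_imp:
  "times_cont_diff (Suc r) f \<Longrightarrow> times_cont_diff r f"
proof (induction r arbitrary: f)
  case 0
  then show ?case
    using continuous_on_times_cont_diff[of "Suc 0" f] by simp
next
  case (Suc r)
  from Suc.prems have "f differentiable (at x)" for x by simp
  moreover from Suc.prems have "times_cont_diff (Suc r) (\<lambda>x. frechet_derivative f (at x) v)" for v
    by (metis times_cont_diff.simps(2))
  ultimately show ?case
    using Suc.IH by simp
qed

lemma times_cont_diff_antimono:
  assumes "times_cont_diff r f" "k \<le> r"
  shows "times_cont_diff k f"
  using assms(2,1) by (induction rule: inc_induct) (simp_all only: times_cont_diff_Suc_imp)

lemma partial_deriv_eq_frechet_fun:
  assumes "times_cont_diff (Suc r) f"
  shows "partial_deriv i f = (\<lambda>x. frechet_derivative f (at x) (axis i 1))"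
  using assms by (auto simp: partial_deriv_eq_frechet)

lemma times_cont_diff_partial_deriv:
  assumes "times_cont_diff (Suc r) f"
  shows "times_cont_diff r (partial_deriv i f)"
  unfolding partial_deriv_eq_frechet_fun[OF assms] using assms by simp

text \<open>
  Differentiating \<open>f (z + s v) - f (z - v) = \<integral>\<^bsub>-1\<^esub>\<^bsup>s\<^esup> (D\<^sub>v f) (z + \<sigma> v) d\<sigma>\<close> first in direction \<open>w\<close>,
  under the integral sign, and then in \<open>s\<close> exchanges the two derivatives.
\<close>
lemma partial_deriv_commute:
  assumes f: "times_cont_diff (Suc (Suc 0)) f"
  shows "partial_deriv i (partial_deriv j f) = partial_deriv j (partial_deriv i f)"
proof
  fix x :: "real^'a"
  define v w :: "real^'a" where "v = axis i 1" and "w = axis j 1"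
  define fv fw fvw fwv where "fv = (\<lambda>x. frechet_derivative f (at x) v)"
    and "fw = (\<lambda>x. frechet_derivative f (at x) w)"
    and "fvw = (\<lambda>x. frechet_derivative fv (at x) w)"
    and "fwv = (\<lambda>x. frechet_derivative fw (at x) v)"
  have pd: "partial_deriv i f = fv" "partial_deriv j f = fw"
    using partial_deriv_eq_frechet_fun[OF f] by (simp_all add: v_def w_def fv_def fw_def)
  have d: "f differentiable at z" "fv differentiable at z" "fw differentiable at z" for z
    using f by (simp_all add: fv_def fw_def)
  have c: "continuous_on UNIV fvw" "continuous_on UNIV fv"
    using f times_cont_diff_Suc_imp[OF f]
    by (simp_all add: fvw_def fv_def)
  have pd2: "partial_deriv j fv x = fvw x" "partial_deriv i fw x = fwv x"
    by (simp_all add: partial_deriv_eq_frechet d v_def w_def fvw_def fwv_def)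
  have cf: "continuous_on S (\<lambda>y. fv (g y))" "continuous_on S (\<lambda>y. fvw (g y))"
    if "continuous_on S g" for S :: "'c::topological_space set" and g
    using c that by (auto intro: continuous_on_compose2)
  have ftc: "integral {-1..s} (\<lambda>\<sigma>. fv (z + \<sigma> *\<^sub>R v)) = f (z + s *\<^sub>R v) - f (z + (-1) *\<^sub>R v)"
    if "-1 \<le> s" for s z
    using that has_vector_derivative_along_line[OF d(1)]
    by (intro integral_unique fundamental_theorem_of_calculus) (auto simp: fv_def)
  have mixed: "integral {-1..s} (\<lambda>\<sigma>. fvw (x + \<sigma> *\<^sub>R v)) = fw (x + s *\<^sub>R v) - fw (x + (-1) *\<^sub>R v)"
    if "-1 \<le> s" for s
  proof -
    have L: "((\<lambda>\<tau>. integral (cbox (-1) s) (\<lambda>\<sigma>. fv ((x + \<sigma> *\<^sub>R v) + \<tau> *\<^sub>R w))) has_vector_derivative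
        integral (cbox (-1) s) (\<lambda>\<sigma>. fvw ((x + \<sigma> *\<^sub>R v) + 0 *\<^sub>R w))) (at 0 within UNIV)"
      using has_vector_derivative_along_line[OF d(2)]
      by (intro leibniz_rule_vector_derivative)
        (auto simp: fvw_def split_beta intro!: integrable_continuous_interval cf[unfolded fvw_def] continuous_intros)
    have "((\<lambda>\<tau>. f ((x + s *\<^sub>R v) + \<tau> *\<^sub>R w) - f ((x + (-1) *\<^sub>R v) + \<tau> *\<^sub>R w)) has_vector_derivative
       fw ((x + s *\<^sub>R v) + 0 *\<^sub>R w) - fw ((x + (-1) *\<^sub>R v) + 0 *\<^sub>R w)) (at 0)"
      unfolding fw_def
      by (intro has_vector_derivative_diff has_vector_derivative_along_line d)
    moreover have "f ((x + s *\<^sub>R v) + \<tau> *\<^sub>R w) - f ((x + (-1) *\<^sub>R v) + \<tau> *\<^sub>R w) =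
       integral (cbox (-1) s) (\<lambda>\<sigma>. fv ((x + \<sigma> *\<^sub>R v) + \<tau> *\<^sub>R w))" for \<tau>
      using ftc[OF that, of "x + \<tau> *\<^sub>R w"] by (simp add: algebra_simps)
    ultimately show ?thesis
      using vector_derivative_unique_at[OF L] by simp
  qed
  \<comment> \<open>Starting the integrals at -1 rather than 0 puts 0 in the interior of the
    interval, so the derivative within \<open>{-1..1}\<close> is two-sided and hence unique.\<close>
  have "((\<lambda>s. integral {-1..s} (\<lambda>\<sigma>. fvw (x + \<sigma> *\<^sub>R v))) has_vector_derivative fvw (x + 0 *\<^sub>R v))
      (at 0 within {-1..1})"
    by (intro integral_has_vector_derivative cf continuous_intros) auto
  moreover have "((\<lambda>s. integral {-1..s} (\<lambda>\<sigma>. fvw (x + \<sigma> *\<^sub>R v))) has_vector_derivative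
       fwv (x + 0 *\<^sub>R v)) (at 0 within {-1..1})"
  proof (rule has_vector_derivative_transform)
    show "((\<lambda>s. fw (x + s *\<^sub>R v) - fw (x + (-1) *\<^sub>R v)) has_vector_derivative
       fwv (x + 0 *\<^sub>R v)) (at 0 within {-1..1})"
      using has_vector_derivative_diff[OF has_vector_derivative_along_line[OF d(3)[of "x + 0 *\<^sub>R v"]]
          has_vector_derivative_const]
      by (simp add: fwv_def)
  qed (auto simp: mixed)
  ultimately have "fvw x = fwv x"
    using at_within_Icc_at[of "-1" "0::real" 1] vector_derivative_unique_at by fastforce
  then show "partial_deriv i (partial_deriv j f) x = partial_deriv j (partial_deriv i f) x"
    by (simp add: pd pd2)
qed

text \<open>Lists remember the order of differentiation, which suits an induction that adds one
  derivative at a time; multi-indices come back once the order is known not to matter. The head of a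
  list is the derivative applied last.\<close>

definition iter_partial :: "'n list \<Rightarrow> (real^'n::finite \<Rightarrow> complex) \<Rightarrow> real^'n \<Rightarrow> complex" where
  "iter_partial L f = foldr partial_deriv L f"

lemma iter_partial_simps [simp]:
  "iter_partial [] f = f"
  "iter_partial (i # L) f = partial_deriv i (iter_partial L f)"
  "iter_partial (L @ M) f = iter_partial L (iter_partial M f)"
  by (simp_all add: iter_partial_def)

lemma times_cont_diff_iter_partial:
  assumes "times_cont_diff (length L + r) f"
  shows "times_cont_diff r (iter_partial L f)"
  using assms
proof (induction L arbitrary: r)
  case (Cons i L)
  then have "times_cont_diff (Suc r) (iter_partial L f)"
    by (simp del: times_cont_diff.simps)
  then show ?case
    using times_cont_diff_partial_deriv by simp
qed simp

text \<open>\<open>partial_deriv i\<close> passes one entry of \<open>M\<close> at a time by the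
  symmetry of second derivatives. The assumed smoothness leaves a function of class C^2 at each
  pass.\<close>

lemma iter_partial_move_to_front:
  assumes "times_cont_diff (Suc (length M)) f"
  shows "iter_partial M (partial_deriv i f) = partial_deriv i (iter_partial M f)"
  using assms
proof (induction M)
  case (Cons j M)
  have "times_cont_diff (Suc (Suc 0)) (iter_partial M f)"
    using Cons.prems by (intro times_cont_diff_iter_partial) (simp del: times_cont_diff.simps)
  then show ?case
    using Cons.IH times_cont_diff_Suc_imp[OF Cons.prems] partial_deriv_commute
    by (simp del: times_cont_diff.simps)
qed simp

text \<open>Induction on \<open>L\<close>: its head occurs in \<open>M\<close>, can be pulled in
  front of everything that precedes it there, and what remains of \<open>M\<close> is a permutation
  of the tail.\<close>

lemma iter_partial_cong_mset:
  assumes "times_cont_diff (length L) f" "mset L = mset M"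
  shows "iter_partial L f = iter_partial M f"
  using assms
proof (induction L arbitrary: M)
  case (Cons i L)
  then have "i \<in> set M"
    by (metis list.set_intros(1) set_mset_mset)
  then obtain M1 M2 where M: "M = M1 @ i # M2"
    by (meson split_list)
  then have L: "mset L = mset (M1 @ M2)"
    using Cons.prems by simp
  have len: "length L = length M1 + length M2"
    using mset_eq_length[OF L] by simp
  have "times_cont_diff (Suc (length M1)) (iter_partial M2 f)"
    using Cons.prems len by (intro times_cont_diff_iter_partial) (simp add: add.commute del: times_cont_diff.simps)
  then show ?case
    using Cons.IH[OF _ L] times_cont_diff_Suc_imp[of "length L" f] Cons.prems(1) M
      iter_partial_move_to_front[of M1 "iter_partial M2 f" i]
    by (simp del: times_cont_diff.simps)
qed simp

lemma multi_deriv_eq_iter_partial: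
  "multi_deriv \<alpha> f =
     iter_partial (concat (map (\<lambda>i. replicate (\<alpha> i) i) (sorted_list_of_set UNIV))) f"
proof -
  have *: "iter_partial (replicate k i) g = (partial_deriv i ^^ k) g" for k and i :: 'a and g
    by (induction k) auto
  have "foldr (\<lambda>i g. (partial_deriv i ^^ \<alpha> i) g) xs f =
     iter_partial (concat (map (\<lambda>i. replicate (\<alpha> i) i) xs)) f" for xs
    by (induction xs) (auto simp: *)
  then show ?thesis
    by (simp add: multi_deriv_def)
qed

text \<open>\<open>multi_deriv\<close> differentiates along the list that runs through the
  coordinates in order and repeats each as often as it occurs in \<open>L\<close>; that list is a
  permutation of \<open>L\<close>.\<close>

lemma iter_partial_eq_multi_deriv:
  assumes "times_cont_diff (length L) f"
  shows "iter_partial L f = multi_deriv (count_list L) f"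
proof -
  \<comment> \<open>Stated for every distinct \<open>xs\<close>, so that the induction on the list
    goes through.\<close>
  have "count (mset (concat (map (\<lambda>i. replicate (count_list L i) i) xs))) j =
     (if j \<in> set xs then count_list L j else 0)" if "distinct xs" for xs j
    using that by (induction xs) (auto simp: count_list_0_iff)
  then have "mset L = mset (concat (map (\<lambda>i. replicate (count_list L i) i) (sorted_list_of_set UNIV)))"
    by (intro multiset_eqI) (simp add: count_mset)
  from iter_partial_cong_mset[OF assms this] show ?thesis
    by (simp add: multi_deriv_eq_iter_partial)
qed

lemma order_of_count_list: "order_of (count_list L) = length L"
  unfolding order_of_def using sum_count_set[of L UNIV] by simp

lemma count_list_in_multi_indices:
  assumes "set L \<subseteq> {i. l < coord_pos i}"
  shows "count_list L \<in> multi_indices l"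
  using assms by (force simp: multi_indices_def count_list_0_iff)

subsection \<open>Inequalities for powers\<close>

text \<open>The tangent to the convex function t^p at t = b lies below the graph; its negative
  constant term is moved to the right, so that nothing is subtracted when the inequality is
  integrated in \<open>ennreal\<close>. It follows from Young's inequality for a^p and b^p with
  weights 1/p and 1 - 1/p.\<close>

lemma powr_above_tangent:
  fixes a b p :: real
  assumes "0 \<le> a" "0 < b" "1 \<le> p"
  shows "p * b powr (p - 1) * a \<le> a powr p + (p - 1) * b powr p"
proof (cases "a = 0")
  case False
  have "(a powr p) powr (1 / p) * (b powr p) powr (1 - 1 / p)
      \<le> 1 / p * a powr p + (1 - 1 / p) * b powr p"
    using assms False by (intro Youngs_inequality_0) auto
  moreover have "p * (1 - 1 / p) = p - 1"
    using assms by (simp add: field_simps)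
  ultimately have "a * b powr (p - 1) \<le> 1 / p * a powr p + (1 - 1 / p) * b powr p"
    using assms False by (simp add: powr_powr)
  then have "p * (a * b powr (p - 1)) \<le> p * (1 / p * a powr p + (1 - 1 / p) * b powr p)"
    using assms by (intro mult_left_mono) auto
  also have "\<dots> = a powr p + (p - 1) * b powr p"
    using assms by (simp add: field_simps)
  finally show ?thesis
    by (simp add: mult_ac)
qed (use assms in auto)

text \<open>Jensen's inequality in a form that allows \<open>a\<close> to have infinite mean:
  \<open>b\<close> is any finite lower bound for it. Integrating the tangent inequality at
  \<open>b\<close> suffices, since the added constant is finite and, in a probability space, equal
  to its own integral, so that it cancels.\<close>

lemma (in prob_space) powr_le_nn_integral_powr:
  assumes [measurable]: "a \<in> borel_measurable M"
    and "\<And>x. 0 \<le> a x" "1 \<le> p" "0 \<le> b" and le: "ennreal b \<le> (\<integral>\<^sup>+x. ennreal (a x) \<partial>M)"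
  shows "ennreal (b powr p) \<le> (\<integral>\<^sup>+x. ennreal (a x powr p) \<partial>M)"
proof (cases "b = 0")
  case False
  then have b: "0 < b"
    using assms by simp
  have "ennreal (b powr p) + ennreal ((p - 1) * b powr p) = ennreal (p * b powr (p - 1)) * ennreal b"
    using b assms by (simp flip: ennreal_plus ennreal_mult add: powr_diff field_simps)
  also have "\<dots> \<le> (\<integral>\<^sup>+x. ennreal (p * b powr (p - 1)) * ennreal (a x) \<partial>M)"
    by (subst nn_integral_cmult) (auto intro!: mult_left_mono le)
  also have "\<dots> \<le> (\<integral>\<^sup>+x. ennreal (a x powr p) + ennreal ((p - 1) * b powr p) \<partial>M)"
    using powr_above_tangent[OF _ b] assms
    by (intro nn_integral_mono) (simp flip: ennreal_plus ennreal_mult)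
  also have "\<dots> = (\<integral>\<^sup>+x. ennreal (a x powr p) \<partial>M) + ennreal ((p - 1) * b powr p)"
    by (subst nn_integral_add) (auto simp: emeasure_space_1)
  finally show ?thesis
    by (simp add: ennreal_add_left_cancel_le add.commute)
qed (use assms in auto)

text \<open>The sum is at most the number of terms times the largest term, whose power is one of the
  summands on the right. This crude bound covers exponents below 1 as well: it serves with p in
  Hardy's inequality and with 1/p when roots are taken.\<close>

lemma sum_powr_le:
  fixes g :: "'a \<Rightarrow> real"
  assumes "finite A" "\<And>i. i \<in> A \<Longrightarrow> 0 \<le> g i" "0 \<le> p"
  shows "(\<Sum>i\<in>A. g i) powr p \<le> real (card A) powr p * (\<Sum>i\<in>A. g i powr p)"
proof (cases "A = {}")
  case False
  define m where "m = Max (g ` A)"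
  have m: "m \<in> g ` A" "\<And>i. i \<in> A \<Longrightarrow> g i \<le> m"
    using assms False by (auto simp: m_def)
  then obtain j where j: "j \<in> A" "m = g j"
    by auto
  have "(\<Sum>i\<in>A. g i) \<le> real (card A) * m"
    using m sum_bounded_above[of A g m] by auto
  then have "(\<Sum>i\<in>A. g i) powr p \<le> (real (card A) * m) powr p"
    using assms by (intro powr_mono2) (auto intro: sum_nonneg)
  also have "\<dots> = real (card A) powr p * g j powr p"
    using j assms by (simp add: powr_mult)
  also have "\<dots> \<le> real (card A) powr p * (\<Sum>i\<in>A. g i powr p)"
    using j assms by (intro mult_left_mono member_le_sum) auto
  finally show ?thesis .
qed auto

subsection \<open>Contraction towards the plane\<close>

text \<open>\<open>coord_pos\<close> is strictly increasing, hence injective, and so by counting a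
  bijection onto \<open>{1..CARD('n)}\<close>.\<close>

lemma card_coord_pos_greater:
  "card {i :: 'n::{finite,linorder}. l < coord_pos i} = CARD('n) - l"
proof -
  have "coord_pos i < coord_pos j" if "i < j" for i j :: 'n
    unfolding coord_pos_def using that by (intro psubset_card_mono) auto
  then have inj: "inj (coord_pos :: 'n \<Rightarrow> nat)"
    by (metis injI less_irrefl neqE)
  have "range (coord_pos :: 'n \<Rightarrow> nat) \<subseteq> {1..CARD('n)}"
    by (auto simp: coord_pos_def Suc_le_eq card_gt_0_iff intro!: card_mono)
  then have range: "range (coord_pos :: 'n \<Rightarrow> nat) = {1..CARD('n)}"
    using inj by (intro card_subset_eq) (auto simp: card_image)
  have "card {i :: 'n. l < coord_pos i} = card (coord_pos ` {i :: 'n. l < coord_pos i})"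
    using inj by (metis card_image inj_on_subset subset_UNIV)
  also have "coord_pos ` {i :: 'n. l < coord_pos i} = {l<..} \<inter> range (coord_pos :: 'n \<Rightarrow> nat)"
    by auto
  also have "\<dots> = {l<..CARD('n)}"
    unfolding range by auto
  finally show ?thesis
    by simp
qed

definition normal_part :: "nat \<Rightarrow> real^'n::{finite,linorder} \<Rightarrow> real^'n::{finite,linorder}" where
  "normal_part l x = (\<chi> i. if l < coord_pos i then x $ i else 0)"

text \<open>The map \<open>T_t\<close>, equal to the identity at t = 1 and to the orthogonal
  projection onto the plane at t = 0; in this form it is visibly affine in \<open>t\<close>.\<close>

definition shrink :: "nat \<Rightarrow> real \<Rightarrow> real^'n::{finite,linorder} \<Rightarrow> real^'n::{finite,linorder}" where
  "shrink l t x = x - (1 - t) *\<^sub>R normal_part l x"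

text \<open>A nearest point of the plane is \<open>x - normal_part l x\<close>: for every
  \<open>y\<close> in the plane, \<open>x - y\<close> has the same normal coordinates as
  \<open>x\<close>.\<close>

lemma plane_dist_eq: "plane_dist l x = norm (normal_part l x)"
proof -
  have "x - normal_part l x \<in> coord_plane l"
    by (simp add: coord_plane_def normal_part_def)
  moreover have "norm (normal_part l x) \<le> dist x y" if "y \<in> coord_plane l" for y
  proof -
    have "norm (normal_part l x) \<le> norm (x - y)"
      using that by (intro norm_le_componentwise_cart) (auto simp: normal_part_def coord_plane_def)
    then show ?thesis
      by (simp add: dist_norm)
  qed
  ultimately show ?thesis
    unfolding plane_dist_def
    by (intro antisym infdist_le2[of "x - normal_part l x"])
      (auto simp: dist_norm infdist_def intro!: cINF_greatest)
qed

lemma normal_part_shrink: "normal_part l (shrink l t x) = t *\<^sub>R normal_part l x"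
  by (simp add: vec_eq_iff normal_part_def shrink_def algebra_simps)

lemma plane_dist_nonneg: "0 \<le> plane_dist l x"
  by (simp add: plane_dist_eq)

lemma plane_dist_shrink: "0 \<le> t \<Longrightarrow> plane_dist l (shrink l t x) = t * plane_dist l x"
  by (simp add: plane_dist_eq normal_part_shrink)

lemma abs_nth_le_plane_dist: "l < coord_pos i \<Longrightarrow> \<bar>x $ i\<bar> \<le> plane_dist l x"
  using component_le_norm_cart[of "normal_part l x" i] by (simp add: plane_dist_eq normal_part_def)

lemma continuous_on_plane_dist [continuous_intros]:
  "continuous_on S g \<Longrightarrow> continuous_on S (\<lambda>x. plane_dist l (g x))"
  unfolding plane_dist_def by (intro continuous_intros)

lemma continuous_on_normal_part [continuous_intros]:
  "continuous_on S g \<Longrightarrow> continuous_on S (\<lambda>x. normal_part l (g x))"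
proof -
  assume "continuous_on S g"
  then have "continuous_on S (\<lambda>x. if l < coord_pos i then g x $ i else 0)" for i
    by (cases "l < coord_pos i") (auto intro!: continuous_intros)
  then show ?thesis
    unfolding normal_part_def by (intro continuous_on_vec_lambda) auto
qed

lemma borel_measurable_plane_dist [measurable]:
  "g \<in> borel_measurable M \<Longrightarrow> (\<lambda>x. plane_dist l (g x)) \<in> borel_measurable M"
  by (intro measurable_compose[of g M borel "plane_dist l"] borel_measurable_continuous_onI continuous_intros)

lemma borel_measurable_shrink [measurable]:
  assumes [measurable]: "t \<in> borel_measurable M" "g \<in> borel_measurable M"
  shows "(\<lambda>x. shrink l (t x) (g x)) \<in> borel_measurable M"
proof -
  have [measurable]: "normal_part l \<in> borel_measurable borel"
    by (intro borel_measurable_continuous_onI continuous_intros)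
  show ?thesis
    unfolding shrink_def by measurable
qed

text \<open>\<open>T_t\<close> is diagonal with entry \<open>t\<close> in the normal directions and
  1 in the others, so its determinant is \<open>t\<close> to the number of normal
  directions.\<close>

lemma nn_integral_shrink:
  fixes h :: "real^'n::{finite,linorder} \<Rightarrow> ennreal"
  assumes "0 < t" and [measurable]: "h \<in> borel_measurable borel"
  shows "(\<integral>\<^sup>+x. h x \<partial>lborel) = ennreal (t ^ (CARD('n) - l)) * (\<integral>\<^sup>+x. h (shrink l t x) \<partial>lborel)"
proof -
  \<comment> \<open>\<open>lborel_affine_euclidean\<close> indexes the diagonal entries by basis
    vectors. The inner product is 1 for a normal basis vector and 0 for a tangential one, so
    \<open>c\<close> takes the values \<open>t\<close> and 1.\<close>
  define c :: "real^'n::{finite,linorder} \<Rightarrow> real" where "c b = 1 - (1 - t) * (normal_part l b \<bullet> b)" for b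
  have c: "c (axis i 1) = (if l < coord_pos i then t else 1)" for i :: 'n
    by (auto simp: c_def inner_axis normal_part_def)
  have T: "0 + (\<Sum>j\<in>Basis. (c j * (x \<bullet> j)) *\<^sub>R j) = shrink l t x" for x :: "real^'n::{finite,linorder}"
  proof -
    have "(\<Sum>j\<in>Basis. (c j * (x \<bullet> j)) *\<^sub>R j) = (\<Sum>i\<in>UNIV. (c (axis i 1) * (x \<bullet> axis i 1)) *\<^sub>R axis i 1)"
      unfolding Basis_vec_def by (subst sum.UNION_disjoint) (auto simp: axis_eq_axis)
    also have "\<dots> = (\<Sum>i\<in>UNIV. (shrink l t x $ i) *s axis i 1)"
      by (intro sum.cong)
        (auto simp: c inner_axis shrink_def normal_part_def scalar_mult_eq_scaleR algebra_simps)
    also have "\<dots> = shrink l t x"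
      by (rule basis_expansion)
    finally show ?thesis
      by simp
  qed
  have "(\<Prod>j\<in>Basis. \<bar>c j\<bar>) = (\<Prod>i\<in>UNIV. \<bar>c (axis i 1 :: real^'n::{finite,linorder})\<bar>)"
    unfolding Basis_vec_def by (subst prod.UNION_disjoint) (auto simp: axis_eq_axis)
  also have "\<dots> = t ^ card {i::'n. l < coord_pos i}"
    using \<open>0 < t\<close> by (simp add: c if_distrib prod.If_cases)
  finally have prod: "(\<Prod>j\<in>Basis. \<bar>c j\<bar>) = t ^ (CARD('n) - l)"
    by (simp add: card_coord_pos_greater)
  have "c j \<noteq> 0" if "j \<in> Basis" for j
    using that \<open>0 < t\<close> by (auto simp: Basis_vec_def c split: if_splits)
  then have "lborel = density (distr lborel borel (shrink l t :: real^'n::{finite,linorder} \<Rightarrow> _)) (\<lambda>_. ennreal (t ^ (CARD('n) - l)))"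
    using lborel_affine_euclidean[of c 0] unfolding T prod by simp
  then have "(\<integral>\<^sup>+x. h x \<partial>lborel) =
      (\<integral>\<^sup>+x. h x \<partial>density (distr lborel borel (shrink l t :: real^'n::{finite,linorder} \<Rightarrow> _)) (\<lambda>_. ennreal (t ^ (CARD('n) - l))))"
    by simp
  also have "\<dots> = (\<integral>\<^sup>+x. ennreal (t ^ (CARD('n) - l)) * h (shrink l t x) \<partial>lborel)"
    by (subst nn_integral_density) (simp_all add: nn_integral_distr)
  also have "\<dots> = ennreal (t ^ (CARD('n) - l)) * (\<integral>\<^sup>+x. h (shrink l t x) \<partial>lborel)"
    by (rule nn_integral_cmult) simp
  finally show ?thesis .
qed

lemma prob_space_powr_density:
  assumes "0 < e"
  shows "prob_space (density lborel (\<lambda>t. ennreal (e * t powr (e - 1)) * indicator {0..1} t))"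
proof (rule prob_spaceI)
  have "((\<lambda>t. e * t powr (e - 1)) has_integral (e * (1 powr (e - 1 + 1) / (e - 1 + 1)))) {0..1}"
    using assms by (intro has_integral_mult_right has_integral_powr_from_0) auto
  then have "(\<integral>\<^sup>+t. ennreal (e * t powr (e - 1)) * indicator {0..1} t \<partial>lborel) = 1"
    using assms by (subst nn_integral_has_integral_lebesgue') auto
  then show "emeasure (density lborel (\<lambda>t. ennreal (e * t powr (e - 1)) * indicator {0..1} t))
      (space (density lborel (\<lambda>t. ennreal (e * t powr (e - 1)) * indicator {0..1} t))) = 1"
    by (simp add: emeasure_density)
qed

subsection \<open>Hardy's inequality\<close>

text \<open>The p-th power of the norm of d^a f, possibly infinite; roots are postponed to the end.
  Points of the plane contribute nothing, because \<open>0 powr a = 0\<close>.\<close>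

definition weighted_integral ::
    "nat \<Rightarrow> real \<Rightarrow> real \<Rightarrow> (real^'n::{finite,linorder} \<Rightarrow> complex) \<Rightarrow> ennreal" where
  "weighted_integral l p a f = (\<integral>\<^sup>+x. ennreal ((plane_dist l x powr a * norm (f x)) powr p) \<partial>lborel)"

text \<open>The fundamental theorem of calculus on the segment from the projection of
  \<open>x\<close>, where \<open>f\<close> vanishes, to \<open>x\<close>. The velocity is the normal
  part of \<open>x\<close>, so only normal partial derivatives occur, with coefficients of modulus
  at most d(x).\<close>

lemma norm_le_nn_integral_shrink:
  fixes f :: "real^'n::{finite,linorder} \<Rightarrow> complex"
  assumes f: "times_cont_diff (Suc 0) f" and f0: "\<And>x. x \<in> coord_plane l \<Longrightarrow> f x = 0"
  shows "ennreal (norm (f x)) \<le>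
    (\<integral>\<^sup>+t. ennreal (plane_dist l x * (\<Sum>i | l < coord_pos i. norm (partial_deriv i f (shrink l t x))))
       * indicator {0..1} t \<partial>lborel)"
proof -
  define J where "J = {i::'n. l < coord_pos i}"
  define q where "q = normal_part l x"
  define D where "D = (\<lambda>t. frechet_derivative f (at (shrink l t x)) q)"
  define B where "B = (\<lambda>t. plane_dist l x * (\<Sum>i\<in>J. norm (partial_deriv i f (shrink l t x))))"
  have shrink: "shrink l t x = (x - q) + t *\<^sub>R q" for t
    by (simp add: shrink_def q_def algebra_simps)
  have diff: "f differentiable at z" for z
    using f by simp
  have "shrink l 0 x \<in> coord_plane l"
    by (simp add: coord_plane_def shrink_def normal_part_def)
  then have "f (shrink l 0 x) = 0"
    by (rule f0)
  then have ftc: "(D has_integral f x) {0..1}"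
    using fundamental_theorem_of_calculus[of 0 1 "\<lambda>t. f (shrink l t x)" D]
      has_vector_derivative_along_line[OF diff, where x = "x - q" and v = q]
    by (simp add: D_def shrink)
  have le: "norm (D t) \<le> B t" for t
  proof -
    have "q = (\<Sum>i\<in>UNIV. (q $ i) *\<^sub>R axis i 1)"
      using basis_expansion[of q] by (simp add: scalar_mult_eq_scaleR)
    also have "\<dots> = (\<Sum>i\<in>J. (x $ i) *\<^sub>R axis i 1)"
      by (intro sum.mono_neutral_cong_right) (auto simp: J_def q_def normal_part_def)
    finally have "D t = (\<Sum>i\<in>J. (x $ i) *\<^sub>R partial_deriv i f (shrink l t x))"
      using linear_frechet_derivative[OF diff]
      by (simp add: D_def partial_deriv_eq_frechet[OF diff] linear_sum linear_scale)
    also have "norm \<dots> \<le> (\<Sum>i\<in>J. norm ((x $ i) *\<^sub>R partial_deriv i f (shrink l t x)))"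
      by (rule norm_sum)
    also have "\<dots> \<le> (\<Sum>i\<in>J. plane_dist l x * norm (partial_deriv i f (shrink l t x)))"
      by (intro sum_mono) (auto simp: J_def intro!: mult_right_mono abs_nth_le_plane_dist)
    finally show ?thesis
      by (simp add: B_def sum_distrib_left)
  qed
  have "continuous_on UNIV (partial_deriv i f)" for i
    using continuous_on_times_cont_diff[OF times_cont_diff_partial_deriv[OF f]] .
  then have "continuous_on S (\<lambda>t. partial_deriv i f (shrink l t x))" for i S
    by (rule continuous_on_compose2) (auto simp: shrink intro!: continuous_intros)
  then have B: "B integrable_on {0..1}"
    unfolding B_def by (intro integrable_continuous_interval continuous_intros)
  have nn: "0 \<le> B t" for t
    by (auto simp: B_def intro!: mult_nonneg_nonneg plane_dist_nonneg sum_nonneg)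
  have "norm (f x) \<le> integral {0..1} B"
    using integral_norm_bound_integral[OF _ B le] ftc by (metis has_integral_integrable integral_unique)
  then have "ennreal (norm (f x)) \<le> ennreal (integral {0..1} B)"
    by (rule ennreal_leI)
  also have "\<dots> = (\<integral>\<^sup>+t. ennreal (B t) * indicator {0..1} t \<partial>lborel)"
    using nn B by (subst nn_integral_has_integral_lebesgue') (auto intro: integrable_integral)
  finally show ?thesis
    by (simp add: B_def J_def)
qed

text \<open>
  The exponent \<open>e\<close> of the probability density \<open>e t\<^bsup>e-1\<^esup>\<close> on \<open>[0, 1]\<close> is chosen such that
  \<open>(s - e) p = k\<close>; then the bound for the inner integral over \<open>x\<close> does not depend on \<open>t\<close>.
\<close>
lemma hardy_inequality:
  fixes f :: "real^'n::{finite,linorder} \<Rightarrow> complex" and l :: nat and p s :: real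
  defines "k \<equiv> CARD('n) - l" and "J \<equiv> {i::'n. l < coord_pos i}"
  defines "e \<equiv> (s * p - real k) / p"
  assumes f: "times_cont_diff (Suc 0) f" and f0: "\<And>x. x \<in> coord_plane l \<Longrightarrow> f x = 0"
    and p: "1 \<le> p" and s: "real k < s * p"
  shows "weighted_integral l p (- s) f
    \<le> ennreal ((real k / e) powr p) * (\<Sum>i\<in>J. weighted_integral l p (1 - s) (partial_deriv i f))"
proof -
  have e: "0 < e" "e * p = s * p - real k"
    using p s by (auto simp: e_def)
  have card: "card J = k"
    by (simp add: J_def k_def card_coord_pos_greater)
  define M where "M = density lborel (\<lambda>t. ennreal (e * t powr (e - 1)) * indicator {0..1::real} t)"
  interpret M: prob_space M
    unfolding M_def using e(1) by (rule prob_space_powr_density)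
  interpret pair_sigma_finite M "lborel :: (real^'n::{finite,linorder}) measure" ..
  have [measurable_cong]: "sets M = sets borel"
    by (simp add: M_def)
  define G where "G = (\<lambda>i x. plane_dist l x powr (1 - s) * norm (partial_deriv i f x))"
  have G0: "0 \<le> G i x" for i x
    by (simp add: G_def)
  have [measurable]: "partial_deriv i f \<in> borel_measurable borel" for i
    using continuous_on_times_cont_diff[OF times_cont_diff_partial_deriv[OF f]]
    by (intro borel_measurable_continuous_onI) simp
  have [measurable]: "G i \<in> borel_measurable borel" for i
    unfolding G_def by measurable
  \<comment> \<open>The weight t^(s-1) of the pointwise estimate divided by the density e t^(e-1) of
    \<open>M\<close>: integrating \<open>a\<close> against \<open>M\<close> restores the Lebesgue
    integral over [0, 1].\<close>
  define a where "a = (\<lambda>t x. t powr (s - e) / e * (\<Sum>i\<in>J. G i (shrink l t x)))"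
  have a0: "0 \<le> a t x" for t x
    using e by (simp add: a_def G0 sum_nonneg)
  have pointwise: "ennreal ((plane_dist l x powr (- s) * norm (f x)) powr p)
      \<le> (\<integral>\<^sup>+t. ennreal (a t x powr p) \<partial>M)" for x
  proof (rule M.powr_le_nn_integral_powr[OF _ a0 p])
    show "(\<lambda>t. a t x) \<in> borel_measurable M"
      unfolding a_def by measurable
    let ?d = "plane_dist l x"
    let ?S = "\<lambda>t. \<Sum>i\<in>J. norm (partial_deriv i f (shrink l t x))"
    have "ennreal (?d powr (- s) * norm (f x)) = ennreal (?d powr (- s)) * ennreal (norm (f x))"
      by (simp add: ennreal_mult)
    also have "\<dots> \<le> ennreal (?d powr (- s)) * (\<integral>\<^sup>+t. ennreal (?d * ?S t) * indicator {0..1} t \<partial>lborel)"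
      unfolding J_def by (intro mult_left_mono norm_le_nn_integral_shrink f f0) auto
    also have "\<dots> = (\<integral>\<^sup>+t. ennreal (?d powr (- s)) * (ennreal (?d * ?S t) * indicator {0..1} t) \<partial>lborel)"
      by (rule nn_integral_cmult [symmetric]) measurable
    also have "\<dots> = (\<integral>\<^sup>+t. (ennreal (e * t powr (e - 1)) * indicator {0..1} t) * ennreal (a t x) \<partial>lborel)"
    proof (rule nn_integral_cong_AE)
      \<comment> \<open>At t = 0 the right-hand side is 0 by the convention for \<open>powr\<close>,
        whatever the left-hand side is, so this point is left out.\<close>
      have "AE t in lborel. t \<noteq> (0::real)"
        by (rule AE_lborel_singleton)
      then show "AE t in lborel. ennreal (?d powr (- s)) * (ennreal (?d * ?S t) * indicator {0..1} t) =
         (ennreal (e * t powr (e - 1)) * indicator {0..1} t) * ennreal (a t x)"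
      proof eventually_elim
        case (elim t)
        show ?case
        proof (cases "t \<in> {0..1}")
          case True
          then have t: "0 < t"
            using elim by simp
          \<comment> \<open>Where d(x) = 0 both sides vanish, because \<open>powr\<close> with base
            0 is 0.\<close>
          have "?d powr (- s) * (?d * ?S t) = ?d powr (1 - s) * ?S t"
            using plane_dist_nonneg[of l x] by (cases "?d = 0") (auto simp: powr_diff powr_minus field_simps)
          also have "\<dots> = e * t powr (e - 1) * a t x"
          proof -
            have "G i (shrink l t x) = t powr (1 - s) * (?d powr (1 - s) * norm (partial_deriv i f (shrink l t x)))" for i
              using t plane_dist_nonneg[of l x] by (simp add: G_def plane_dist_shrink powr_mult)
            then have a: "a t x = t powr (s - e) / e * (t powr (1 - s) * (?d powr (1 - s) * ?S t))"
              by (simp add: a_def sum_distrib_left)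
            have "t powr (e - 1) * (t powr (s - e) * t powr (1 - s)) = 1"
              using t by (simp flip: powr_add)
            then have "?d powr (1 - s) * ?S t =
                t powr (e - 1) * (t powr (s - e) * t powr (1 - s)) * (?d powr (1 - s) * ?S t)"
              by simp
            also have "\<dots> = e * t powr (e - 1) * a t x"
              using e by (simp add: a mult_ac)
            finally show ?thesis .
          qed
          finally show ?thesis
            using True e a0[of t x] plane_dist_nonneg[of l x]
            by (simp flip: ennreal_mult add: sum_nonneg)
        qed simp
      qed
    qed
    also have "\<dots> = (\<integral>\<^sup>+t. ennreal (a t x) \<partial>M)"
      unfolding M_def a_def by (subst nn_integral_density) (auto simp: mult_ac)
    finally show "ennreal (?d powr (- s) * norm (f x)) \<le> (\<integral>\<^sup>+t. ennreal (a t x) \<partial>M)" .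
  qed simp
  \<comment> \<open>In the constant, 1/e stems from normalising the density and k from
    \<open>sum_powr_le\<close> over the k normal directions.\<close>
  have average: "(\<integral>\<^sup>+x. ennreal (a t x powr p) \<partial>lborel)
      \<le> ennreal ((real k / e) powr p) * (\<Sum>i\<in>J. weighted_integral l p (1 - s) (partial_deriv i f))"
    if t: "0 < t" for t
  proof -
    have "a t x powr p \<le> (t powr (s - e) / e) powr p * (real k powr p * (\<Sum>i\<in>J. G i (shrink l t x) powr p))" for x
      unfolding a_def using e p sum_powr_le[of J "\<lambda>i. G i (shrink l t x)" p] G0 card
      by (subst powr_mult) (auto intro!: sum_nonneg mult_left_mono)
    also have "(t powr (s - e) / e) powr p * (real k powr p * A) = (real k / e) powr p * (t ^ k * A)" for A
    proof -
      \<comment> \<open>This is what \<open>e\<close> was chosen for: the power of \<open>t\<close>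
        becomes t^k, the Jacobian of \<open>T_t\<close>, and \<open>nn_integral_shrink\<close>
        absorbs it.\<close>
      have "(s - e) * p = real k"
        using e by (simp add: algebra_simps)
      then have "(t powr (s - e)) powr p = t ^ k"
        using t by (simp add: powr_powr powr_realpow)
      then show ?thesis
        using e by (simp add: powr_divide field_simps)
    qed
    finally have "(\<integral>\<^sup>+x. ennreal (a t x powr p) \<partial>lborel)
       \<le> (\<integral>\<^sup>+x. ennreal ((real k / e) powr p * (t ^ k * (\<Sum>i\<in>J. G i (shrink l t x) powr p))) \<partial>lborel)"
      by (intro nn_integral_mono ennreal_leI)
    also have "\<dots> = (\<integral>\<^sup>+x. ennreal ((real k / e) powr p) * (ennreal (t ^ k) * (\<Sum>i\<in>J. ennreal (G i (shrink l t x) powr p))) \<partial>lborel)"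
      using t by (simp add: ennreal_mult sum_nonneg flip: sum_ennreal)
    also have "\<dots> = ennreal ((real k / e) powr p) * (ennreal (t ^ k) * (\<Sum>i\<in>J. \<integral>\<^sup>+x. ennreal (G i (shrink l t x) powr p) \<partial>lborel))"
      by (simp add: nn_integral_cmult nn_integral_sum del: sum_ennreal)
    also have "ennreal (t ^ k) * (\<Sum>i\<in>J. \<integral>\<^sup>+x. ennreal (G i (shrink l t x) powr p) \<partial>lborel)
        = (\<Sum>i\<in>J. \<integral>\<^sup>+x. ennreal (G i x powr p) \<partial>lborel)"
      unfolding sum_distrib_left
      by (intro sum.cong refl) (simp add: k_def nn_integral_shrink[OF t, where l = l and h = "\<lambda>x. ennreal (G _ x powr p)"])
    finally show ?thesis
      by (simp add: weighted_integral_def G_def)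
  qed
  have "weighted_integral l p (- s) f \<le> (\<integral>\<^sup>+x. \<integral>\<^sup>+t. ennreal (a t x powr p) \<partial>M \<partial>lborel)"
    unfolding weighted_integral_def by (intro nn_integral_mono pointwise)
  also have "\<dots> = (\<integral>\<^sup>+t. \<integral>\<^sup>+x. ennreal (a t x powr p) \<partial>lborel \<partial>M)"
    unfolding a_def by (intro Fubini') measurable
  also have "\<dots> \<le> (\<integral>\<^sup>+t. ennreal ((real k / e) powr p) *
      (\<Sum>i\<in>J. weighted_integral l p (1 - s) (partial_deriv i f)) \<partial>M)"
  proof (rule nn_integral_mono_AE)
    have "AE t in lborel. t \<noteq> (0::real)"
      by (rule AE_lborel_singleton)
    then have "AE t in M. 0 < t"
      unfolding M_def by (subst AE_density) (auto elim!: eventually_mono split: split_indicator_asm)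
    then show "AE t in M. (\<integral>\<^sup>+x. ennreal (a t x powr p) \<partial>lborel) \<le> ennreal ((real k / e) powr p) *
      (\<Sum>i\<in>J. weighted_integral l p (1 - s) (partial_deriv i f))"
      by eventually_elim (rule average)
  qed
  also have "\<dots> = ennreal ((real k / e) powr p) * (\<Sum>i\<in>J. weighted_integral l p (1 - s) (partial_deriv i f))"
    by (simp add: M.emeasure_space_1)
  finally show ?thesis .
qed

subsection \<open>Iteration\<close>

text \<open>Induction on \<open>r\<close> with \<open>s\<close> arbitrary: Hardy's inequality passes
  from \<open>f\<close> and \<open>s\<close> to the normal derivatives of \<open>f\<close> and s -
  1, while the lower bound for \<open>s\<close> drops by 1 together with \<open>r\<close>. The
  weights match because r - (s - 1) = (r + 1) - s.\<close>

lemma weighted_integral_le_iter_partial: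
  fixes l r :: nat and p s :: real
  defines "J \<equiv> {i::'n::{finite,linorder}. l < coord_pos i}"
  assumes p: "1 \<le> p" and s: "r = 0 \<or> real r - 1 + real (CARD('n) - l) / p < s"
  shows "\<exists>C\<ge>0. \<forall>f. times_cont_diff r f \<longrightarrow>
    (\<forall>L. set L \<subseteq> J \<longrightarrow> length L < r \<longrightarrow> (\<forall>x\<in>coord_plane l. iter_partial L f x = 0)) \<longrightarrow>
    weighted_integral l p (- s) f \<le>
      ennreal C * (\<Sum>L | set L \<subseteq> J \<and> length L = r. weighted_integral l p (real r - s) (iter_partial L f))"
  using s
proof (induction r arbitrary: s)
  case 0
  have "{L. set L \<subseteq> J \<and> length L = 0} = {[]}"
    by auto
  then show ?case
    by (intro exI[of _ 1]) simp
next
  case (Suc r)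
  define k where "k = CARD('n) - l"
  define H where "H = (real k / ((s * p - real k) / p)) powr p"
  have "0 \<le> real k / p"
    using p by simp
  have "real k / p < s"
    using Suc.prems by (simp add: k_def)
  then have ks: "real k < s * p"
    using p by (simp add: field_simps)
  have "r = 0 \<or> real r - 1 + real (CARD('n) - l) / p < s - 1"
    using Suc.prems by simp
  from Suc.IH[OF this] obtain C where "0 \<le> C"
    and C: "\<And>f. times_cont_diff r f \<Longrightarrow>
      (\<And>L x. set L \<subseteq> J \<Longrightarrow> length L < r \<Longrightarrow> x \<in> coord_plane l \<Longrightarrow> iter_partial L f x = 0) \<Longrightarrow>
      weighted_integral l p (1 - s) f \<le> ennreal C *
        (\<Sum>L | set L \<subseteq> J \<and> length L = r. weighted_integral l p (real (Suc r) - s) (iter_partial L f))"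
    by (auto simp: algebra_simps)
  show ?case
  \<comment> \<open>Hardy's constant, the number of normal directions and the constant of the
    induction hypothesis; the contribution of each direction is bounded by \<open>C\<close> times
    the full sum \<open>R\<close>.\<close>
  proof (intro exI[of _ "H * (card J * C)"] conjI allI impI)
    show "0 \<le> H * (card J * C)"
      using \<open>0 \<le> C\<close> by (simp add: H_def)
  next
    fix f :: "real^'n::{finite,linorder} \<Rightarrow> complex"
    assume f: "times_cont_diff (Suc r) f"
      and f0: "\<forall>L. set L \<subseteq> J \<longrightarrow> length L < Suc r \<longrightarrow> (\<forall>x\<in>coord_plane l. iter_partial L f x = 0)"
    define R where "R = (\<Sum>L | set L \<subseteq> J \<and> length L = Suc r.
      weighted_integral l p (real (Suc r) - s) (iter_partial L f))"
    have fin: "finite {L. set L \<subseteq> J \<and> length L = m}" for m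
      by (intro finite_lists_length_eq) simp
    have partial: "weighted_integral l p (1 - s) (partial_deriv i f) \<le> ennreal C * R" if "i \<in> J" for i
    proof -
      have "weighted_integral l p (1 - s) (partial_deriv i f) \<le> ennreal C *
        (\<Sum>L | set L \<subseteq> J \<and> length L = r.
          weighted_integral l p (real (Suc r) - s) (iter_partial L (partial_deriv i f)))"
      proof (rule C[OF times_cont_diff_partial_deriv[OF f]])
        fix L and x :: "real^'n::{finite,linorder}"
        assume "set L \<subseteq> J" "length L < r" "x \<in> coord_plane l"
        then show "iter_partial L (partial_deriv i f) x = 0"
          using f0[rule_format, of "L @ [i]" x] \<open>i \<in> J\<close> by simp
      qed
      \<comment> \<open>Appending \<open>i\<close> embeds the lists of length r into those of length
        r + 1, with \<open>butlast\<close> as left inverse; all terms are nonnegative, so the sum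
        can only grow.\<close>
      also have "(\<Sum>L | set L \<subseteq> J \<and> length L = r.
          weighted_integral l p (real (Suc r) - s) (iter_partial L (partial_deriv i f))) \<le> R"
        unfolding R_def using \<open>i \<in> J\<close>
        by (intro sum_le_included[where i = butlast] fin ballI)
          (auto intro!: exI[where x = "_ @ [i]"])
      finally show ?thesis
        by (simp add: mult_left_mono)
    qed
    have "times_cont_diff (Suc 0) f"
      using f by (rule times_cont_diff_antimono) simp
    moreover have "f x = 0" if "x \<in> coord_plane l" for x
      using f0[rule_format, of "[]" x] that by simp
    ultimately have "weighted_integral l p (- s) f \<le>
        ennreal H * (\<Sum>i\<in>J. weighted_integral l p (1 - s) (partial_deriv i f))"
      unfolding H_def k_def J_def by (rule hardy_inequality) (use p ks in \<open>auto simp: k_def\<close>)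
    also have "\<dots> \<le> ennreal H * (of_nat (card J) * (ennreal C * R))"
      using sum_bounded_above[OF partial] by (intro mult_left_mono) auto
    also have "\<dots> = ennreal (H * (card J * C)) * R"
      using \<open>0 \<le> C\<close> by (simp add: H_def ennreal_mult mult_ac flip: ennreal_of_nat_eq_real_of_nat)
    finally show "weighted_integral l p (- s) f \<le> ennreal (H * (card J * C)) * R" .
  qed
qed

text \<open>Passes from lists to multi-indices through \<open>count_list\<close>. Different lists
  may yield the same multi-index, so each list term is bounded by the whole sum over multi-indices,
  which multiplies the constant by the number of lists.\<close>

lemma weighted_integral_le_multi_deriv:
  fixes l r :: nat and p s :: real
  assumes p: "1 \<le> p" and r: "1 \<le> r"
    and s: "real r - 1 + real (CARD('n::{finite,linorder}) - l) / p < s"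
  shows "\<exists>C\<ge>0. \<forall>f :: real^'n::{finite,linorder} \<Rightarrow> complex. times_cont_diff r f \<longrightarrow>
    (\<forall>\<beta>\<in>multi_indices l. order_of \<beta> \<le> r - 1 \<longrightarrow> (\<forall>x\<in>coord_plane l. multi_deriv \<beta> f x = 0)) \<longrightarrow>
    weighted_integral l p (- s) f \<le> ennreal C *
      (\<Sum>\<alpha> | \<alpha> \<in> multi_indices l \<and> order_of \<alpha> = r.
         weighted_integral l p (- s + real r) (multi_deriv \<alpha> f))"
proof -
  define J where "J = {i::'n. l < coord_pos i}"
  define Ls where "Ls = {L. set L \<subseteq> J \<and> length L = r}"
  from weighted_integral_le_iter_partial[OF p, where 'n='n and l=l and r=r and s=s] s
  obtain C where "0 \<le> C"
    and C: "\<And>f. times_cont_diff r f \<Longrightarrow>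
      (\<And>L x. set L \<subseteq> J \<Longrightarrow> length L < r \<Longrightarrow> x \<in> coord_plane l \<Longrightarrow> iter_partial L f x = 0) \<Longrightarrow>
      weighted_integral l p (- s) f \<le>
        ennreal C * (\<Sum>L\<in>Ls. weighted_integral l p (- s + real r) (iter_partial L f))"
    by (auto simp: J_def Ls_def)
  show ?thesis
  proof (intro exI[of _ "C * card Ls"] conjI allI impI)
    show "0 \<le> C * card Ls"
      using \<open>0 \<le> C\<close> by simp
  next
    fix f :: "real^'n::{finite,linorder} \<Rightarrow> complex"
    assume f: "times_cont_diff r f" and f0: "\<forall>\<beta>\<in>multi_indices l. order_of \<beta> \<le> r - 1 \<longrightarrow>
      (\<forall>x\<in>coord_plane l. multi_deriv \<beta> f x = 0)"
    define R where "R = (\<Sum>\<alpha> | \<alpha> \<in> multi_indices l \<and> order_of \<alpha> = r.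
         weighted_integral l p (- s + real r) (multi_deriv \<alpha> f))"
    have eq: "iter_partial L f = multi_deriv (count_list L) f" if "length L \<le> r" for L
      using times_cont_diff_antimono[OF f that] by (rule iter_partial_eq_multi_deriv)
    have "weighted_integral l p (- s) f \<le>
        ennreal C * (\<Sum>L\<in>Ls. weighted_integral l p (- s + real r) (iter_partial L f))"
    proof (rule C[OF f])
      fix L and x :: "real^'n::{finite,linorder}"
      assume L: "set L \<subseteq> J" "length L < r" and x: "x \<in> coord_plane l"
      have "count_list L \<in> multi_indices l"
        using L by (intro count_list_in_multi_indices) (simp add: J_def)
      then show "iter_partial L f x = 0"
        using f0 L x by (simp add: eq order_of_count_list)
    qed
    also have "\<dots> \<le> ennreal C * (of_nat (card Ls) * R)"
    proof (intro mult_left_mono sum_bounded_above)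
      fix L
      assume "L \<in> Ls"
      then have "count_list L \<in> multi_indices l" "length L = r"
        by (auto simp: Ls_def J_def intro: count_list_in_multi_indices)
      then show "weighted_integral l p (- s + real r) (iter_partial L f) \<le> R"
        unfolding R_def eq[OF eq_refl[OF \<open>length L = r\<close>]]
        using finite_multi_indices_order[where l = l and r = r]
        by (intro member_le_sum) (auto simp: order_of_count_list)
    qed simp
    also have "\<dots> = ennreal (C * card Ls) * R"
      using \<open>0 \<le> C\<close> by (simp add: ennreal_mult mult_ac flip: ennreal_of_nat_eq_real_of_nat)
    finally show "weighted_integral l p (- s) f \<le> ennreal (C * card Ls) * R" .
  qed
qed

section \<open>From integrals to norms: p-th roots\<close>

definition ennreal_root :: "real \<Rightarrow> ennreal \<Rightarrow> ennreal" where
  "ennreal_root p x = (if x = \<infinity> then \<infinity> else ennreal (enn2real x powr (1 / p)))"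

lemma Lp_norm_eq_ennreal_root:
  "Lp_norm p (\<lambda>x. of_real (plane_dist l x powr a) * g x) = ennreal_root p (weighted_integral l p a g)"
  by (simp add: Lp_norm_def ennreal_root_def weighted_integral_def norm_mult)

text \<open>If some \<open>y i\<close> is infinite, the right-hand side is infinite as soon as the
  constant is positive. As \<open>C * card A\<close> may be 0, and 0 times infinity is 0 in
  \<open>ennreal\<close>, 1 is added. Otherwise everything is finite and \<open>sum_powr_le\<close>
  applies with exponent 1/p.\<close>

lemma ennreal_root_le_sum:
  fixes y :: "'a \<Rightarrow> ennreal"
  assumes "finite A" "1 \<le> p" "0 \<le> C" and le: "x \<le> ennreal C * (\<Sum>i\<in>A. y i)"
  shows "ennreal_root p x \<le> ennreal ((C * card A) powr (1 / p) + 1) * (\<Sum>i\<in>A. ennreal_root p (y i))"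
proof (cases "\<exists>i\<in>A. y i = \<infinity>")
  case True
  then have "(\<Sum>i\<in>A. ennreal_root p (y i)) = \<infinity>"
    using assms(1) by (auto simp: ennreal_sum_eq_top ennreal_root_def)
  then show ?thesis
    by (simp add: ennreal_mult_top add_nonneg_pos)
next
  case False
  define b where "b i = enn2real (y i)" for i
  have y: "y i = ennreal (b i)" if "i \<in> A" for i
    using False that by (auto simp: b_def less_top)
  have b0: "0 \<le> b i" for i
    by (simp add: b_def)
  have x: "x \<le> ennreal (C * (\<Sum>i\<in>A. b i))"
    using le y b0 assms by (simp add: ennreal_mult sum_nonneg)
  then have "x \<noteq> \<infinity>"
    by (auto simp: top_unique)
  have "enn2real x powr (1 / p) \<le> (C * (\<Sum>i\<in>A. b i)) powr (1 / p)"
    using x assms b0 by (intro powr_mono2 enn2real_leI) (auto intro!: mult_nonneg_nonneg sum_nonneg)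
  also have "\<dots> \<le> C powr (1 / p) * (real (card A) powr (1 / p) * (\<Sum>i\<in>A. b i powr (1 / p)))"
    using assms b0 by (subst powr_mult) (auto intro!: mult_left_mono sum_powr_le sum_nonneg)
  also have "\<dots> = (C * card A) powr (1 / p) * (\<Sum>i\<in>A. b i powr (1 / p))"
    using assms by (simp add: powr_mult)
  also have "\<dots> \<le> ((C * card A) powr (1 / p) + 1) * (\<Sum>i\<in>A. b i powr (1 / p))"
    by (intro mult_right_mono sum_nonneg) auto
  finally have "ennreal_root p x \<le> ennreal (((C * card A) powr (1 / p) + 1) * (\<Sum>i\<in>A. b i powr (1 / p)))"
    using \<open>x \<noteq> \<infinity>\<close> by (simp add: ennreal_root_def ennreal_leI)
  also have "\<dots> = ennreal ((C * card A) powr (1 / p) + 1) * (\<Sum>i\<in>A. ennreal_root p (y i))"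
    using y b0 by (simp add: ennreal_mult sum_nonneg ennreal_root_def)
  finally show ?thesis .
qed

theorem lemma3p16:
  fixes l r :: nat and p s :: real
  assumes "l < CARD('n::{finite,linorder})"
    and "1 \<le> r"
    and "1 \<le> p"
    and "s > real r - 1 + (real CARD('n) - real l) / p"
  shows "\<exists>c::real. c > 0 \<and>
    (\<forall>f :: real^'n::{finite,linorder} \<Rightarrow> complex.
       f \<in> C_space r \<longrightarrow>
       (\<forall>\<beta> \<in> multi_indices l. order_of \<beta> \<le> r - 1 \<longrightarrow>
          (\<forall>x \<in> coord_plane l. multi_deriv \<beta> f x = 0)) \<longrightarrow>
       Lp_norm p (\<lambda>x. of_real (plane_dist l x powr (- s)) * f x)
         \<le> ennreal c *
            (\<Sum>\<alpha> | \<alpha> \<in> multi_indices l \<and> order_of \<alpha> = r.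
               Lp_norm p (\<lambda>x. of_real (plane_dist l x powr (- s + real r)) * multi_deriv \<alpha> f x)))"
proof -
  define A where "A = {\<alpha> :: 'n \<Rightarrow> nat. \<alpha> \<in> multi_indices l \<and> order_of \<alpha> = r}"
  have "finite A"
    unfolding A_def by (rule finite_multi_indices_order)
  \<comment> \<open>Since l < n, the truncated difference of natural numbers agrees with the real
    one.\<close>
  have "real r - 1 + real (CARD('n) - l) / p < s"
    using assms by (simp add: of_nat_diff)
  from weighted_integral_le_multi_deriv[OF assms(3,2) this]
  obtain C where "0 \<le> C" and C: "\<And>f :: real^'n::{finite,linorder} \<Rightarrow> complex. times_cont_diff r f \<Longrightarrow>
    (\<forall>\<beta>\<in>multi_indices l. order_of \<beta> \<le> r - 1 \<longrightarrow> (\<forall>x\<in>coord_plane l. multi_deriv \<beta> f x = 0)) \<Longrightarrow>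
    weighted_integral l p (- s) f \<le> ennreal C *
      (\<Sum>\<alpha>\<in>A. weighted_integral l p (- s + real r) (multi_deriv \<alpha> f))"
    unfolding A_def by blast
  show ?thesis
    unfolding Lp_norm_eq_ennreal_root A_def[symmetric]
  proof (intro exI[of _ "(C * card A) powr (1 / p) + 1"] conjI allI impI)
    show "0 < (C * card A) powr (1 / p) + 1"
      by (simp add: add_nonneg_pos)
  qed (intro ennreal_root_le_sum C \<open>finite A\<close> \<open>1 \<le> p\<close> \<open>0 \<le> C\<close>, simp_all add: C_space_def)
qed

end
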